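(* Let $a<b$ be real numbers, let $\alpha\in(1,2]$ and $\beta\in[0,\alpha-1]$. Assume $f:[a,b]\times\mathbb{R}\to\mathbb{R}$ is continuous and satisfies a uniform Lipschitz condition with respect to the second variable on $[a,b]\times\mathbb{R}$ with Lipschitz constant $K>0$; that is, $$|f(t,u_1)-f(t,u_2)|\le K|u_1-u_2|\quad\text{for all }(t,u_1),(t,u_2)\in[a,b]\times\mathbb{R}.$$ If $$b-a<\left[\frac{(\alpha-\beta)^{\alpha}\,\Gamma(\alpha+1)}{K(\alpha-1)^{\alpha-1}}\right]^{1/\alpha},$$ then the boundary value problem $$D_{a^+}^{\alpha}u+f(t,u)=0,\quad t\in[a,b],\qquad u(a)=0,\quad D_{a^+}^{\beta}u(b)=0,$$ has a unique solution on $[a,b]$.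
   Context: For $\nu>0$, the Riemann-Liouville fractional integral of order $\nu$ of $u:[a,b]\to\mathbb{R}$ is $I_{a^+}^{\nu}u(t)=\frac{1}{\Gamma(\nu)}\int_a^t(t-s)^{\nu-1}u(s)\,ds$, and $I_{a^+}^{0}u=u$. For a positive integer $n$ and $n-1<\gamma\le n$, the Riemann-Liouville fractional derivative of order $\gamma$ is $D_{a^+}^{\gamma}u(t)=\frac{d^n}{dt^n}I_{a^+}^{n-\gamma}u(t)$ (so for $\gamma=n$ it is the classical $n$-th derivative), and $D_{a^+}^{0}u=u$. Derivatives at the endpoints of $[a,b]$ are one-sided. A solution is a continuous function $u:[a,b]\to\mathbb{R}$ for which $D_{a^+}^{\alpha}u$ is defined on $[a,b]$ and which satisfies the equation on $[a,b]$ and the boundary conditions. *)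

theory Defs
  imports "HOL-Analysis.Analysis"
begin

definition RL_integral :: "real \<Rightarrow> real \<Rightarrow> (real \<Rightarrow> real) \<Rightarrow> real \<Rightarrow> real" where
  "RL_integral a \<nu> u t =
     (if \<nu> = 0 then u t
      else 1 / Gamma \<nu> * integral {a..t} (\<lambda>s. (t - s) powr (\<nu> - 1) * u s))"

text \<open>
  Iterated derivatives relative to a set \<open>S\<close>. For \<open>S = {a..b}\<close> the derivatives at
  \<open>a\<close> and \<open>b\<close> are the one-sided ones, and only the values of the function on
  \<open>{a..b}\<close> matter.
\<close>

primrec nth_deriv_within :: "nat \<Rightarrow> real set \<Rightarrow> (real \<Rightarrow> real) \<Rightarrow> real \<Rightarrow> real" where
  "nth_deriv_within 0 S g = g"
| "nth_deriv_within (Suc n) S g =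
     (\<lambda>t. vector_derivative (nth_deriv_within n S g) (at t within S))"

text \<open>
  Existence of the \<open>n\<close>-th derivative at the single point \<open>t\<close>: the preceding
  derivative exists throughout a neighbourhood of \<open>t\<close> in \<open>S\<close> and is differentiable
  at \<open>t\<close>. Without this condition the value of \<open>nth_deriv_within\<close> is arbitrary.
\<close>

primrec nth_differentiable_within ::
    "nat \<Rightarrow> real set \<Rightarrow> (real \<Rightarrow> real) \<Rightarrow> real \<Rightarrow> bool" where
  "nth_differentiable_within 0 S g = (\<lambda>t. True)"
| "nth_differentiable_within (Suc n) S g =
     (\<lambda>t. (\<forall>\<^sub>F s in nhds t. s \<in> S \<longrightarrow> nth_differentiable_within n S g s) \<and>
          nth_deriv_within n S g differentiable (at t within S))"

text \<open>
  For \<open>\<gamma> > 0\<close> the integer \<open>n\<close> with \<open>n - 1 < \<gamma> \<le> n\<close> is the ceiling of \<open>\<gamma>\<close>;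
  for \<open>\<gamma> = 0\<close> the ceiling is \<open>0\<close>, and the formula reduces to the convention that
  the derivative of order \<open>0\<close> of \<open>u\<close> is \<open>u\<close> itself.
\<close>

definition RL_deriv ::
    "real \<Rightarrow> real \<Rightarrow> real \<Rightarrow> (real \<Rightarrow> real) \<Rightarrow> real \<Rightarrow> real" where
  "RL_deriv a b \<gamma> u =
     (let n = nat \<lceil>\<gamma>\<rceil> in nth_deriv_within n {a..b} (RL_integral a (real n - \<gamma>) u))"

definition RL_differentiable ::
    "real \<Rightarrow> real \<Rightarrow> real \<Rightarrow> (real \<Rightarrow> real) \<Rightarrow> real \<Rightarrow> bool" where
  "RL_differentiable a b \<gamma> u =
     (let n = nat \<lceil>\<gamma>\<rceil> in
        nth_differentiable_within n {a..b} (RL_integral a (real n - \<gamma>) u))"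

lemma RL_deriv_0: "RL_deriv a b 0 u = u"
  by (simp add: RL_deriv_def RL_integral_def fun_eq_iff)

lemma RL_deriv_of_nat: "RL_deriv a b (real n) u = nth_deriv_within n {a..b} u"
proof -
  have "RL_integral a 0 u = u"
    by (simp add: RL_integral_def fun_eq_iff)
  then show ?thesis
    by (simp add: RL_deriv_def)
qed

lemma RL_deriv_eq:
  assumes "n > 0" "real n - 1 < \<gamma>" "\<gamma> \<le> real n"
  shows "RL_deriv a b \<gamma> u = nth_deriv_within n {a..b} (RL_integral a (real n - \<gamma>) u)"
proof -
  have "\<lceil>\<gamma>\<rceil> = int n"
    using assms by (intro ceiling_unique) auto
  then show ?thesis
    by (simp add: RL_deriv_def)
qed

definition is_BVP_solution ::
    "real \<Rightarrow> real \<Rightarrow> real \<Rightarrow> real \<Rightarrow> (real \<Rightarrow> real \<Rightarrow> real) \<Rightarrow> (real \<Rightarrow> real) \<Rightarrow> bool" where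
  "is_BVP_solution a b \<alpha> \<beta> f u \<longleftrightarrow>
     continuous_on {a..b} u \<and>
     (\<forall>t\<in>{a..b}. RL_differentiable a b \<alpha> u t \<and> RL_deriv a b \<alpha> u t + f t (u t) = 0) \<and>
     u a = 0 \<and>
     RL_differentiable a b \<beta> u b \<and> RL_deriv a b \<beta> u b = 0"

end

theory Submission
  imports Defs
begin

text \<open>
  Write \<open>I\<^sup>\<nu>\<close> for the Riemann-Liouville integral of order \<open>\<nu>\<close> based at \<open>a\<close>. Three facts about
  continuous functions invert the differential equation: the semigroup law
  \<open>I\<^sup>\<mu> I\<^sup>\<nu> = I\<^bsup>\<mu>+\<nu>\<^esup>\<close> (\<open>RL_integral_semigroup\<close>), the rule that \<open>I\<^bsup>\<nu>+1\<^esup> h\<close> has derivative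
  \<open>I\<^sup>\<nu> h\<close>, and the injectivity of \<open>I\<^sup>\<nu>\<close> for \<open>\<nu> \<le> 1\<close>. If \<open>g\<close> is continuous, then \<open>D\<^sup>\<alpha> u + g = 0\<close>
  says that \<open>I\<^bsup>2-\<alpha>\<^esup> u\<close> has second derivative \<open>-g\<close>. Integrating twice, and using \<open>u(a) = 0\<close>,
  this becomes \<open>I\<^bsup>2-\<alpha>\<^esup> u = c I\<^sup>1 1 - I\<^sup>2 g = I\<^bsup>2-\<alpha>\<^esup> (c I\<^bsup>\<alpha>-1\<^esup> 1 - I\<^sup>\<alpha> g)\<close>, so
  \<open>u = c I\<^bsup>\<alpha>-1\<^esup> 1 - I\<^sup>\<alpha> g\<close>. The condition at \<open>b\<close> reads
  \<open>c I\<^bsup>\<alpha>-\<beta>-1\<^esup> 1(b) = I\<^bsup>\<alpha>-\<beta>\<^esup> g(b)\<close> and fixes \<open>c\<close>. Hence the solutions are the continuous fixed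
  points of \<open>u \<mapsto> G(f(\<cdot>, u(\<cdot>)))\<close>, where \<open>G\<close> is the Green operator (\<open>is_BVP_solution_iff_green_op\<close>).

  The operator \<open>G\<close> is positive (\<open>green_op_nonneg\<close>), so its norm for the uniform norm is
  the maximum of \<open>G 1\<close>. With \<open>x = t - a\<close> and \<open>A = (b - a) / (\<alpha> - \<beta>)\<close> one has
  \<open>G 1 (t) = x\<^bsup>\<alpha>-1\<^esup> (\<alpha> A - x) / \<Gamma>(\<alpha>+1)\<close>, which is largest at \<open>x = (\<alpha> - 1) A\<close>, with value
  \<open>(\<alpha>-1)\<^bsup>\<alpha>-1\<^esup> A\<^sup>\<alpha> / \<Gamma>(\<alpha>+1)\<close>. The hypothesis on \<open>b - a\<close> says that \<open>K\<close> times this value is below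
  \<open>1\<close>, so the map is a contraction and Banach's theorem applies.

  The semigroup law is usually proved by exchanging integrals. Here it comes from density:
  on powers of \<open>t - a\<close> it is the Beta integral, both sides are continuous in the uniform norm,
  and polynomials are dense.
\<close>

section \<open>The Riemann-Liouville integral of continuous functions\<close>

lemma RL_integral_zero_order [simp]: "RL_integral a 0 h = h"
  by (simp add: RL_integral_def fun_eq_iff)

lemma RL_integral_start: "\<nu> \<noteq> 0 \<Longrightarrow> RL_integral a \<nu> h a = 0"
  by (simp add: RL_integral_def)

lemma RL_integral_cong:
  assumes "\<And>s. s \<in> {a..b} \<Longrightarrow> h s = k s" "t \<in> {a..b}"
  shows "RL_integral a \<nu> h t = RL_integral a \<nu> k t"
proof -
  have "integral {a..t} (\<lambda>s. (t - s) powr (\<nu> - 1) * h s)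
      = integral {a..t} (\<lambda>s. (t - s) powr (\<nu> - 1) * k s)"
    by (intro integral_cong) (use assms in auto)
  then show ?thesis
    using assms by (simp add: RL_integral_def)
qed

lemma RL_integral_one: "RL_integral a 1 h t = integral {a..t} h"
proof -
  have "integral {a..t} (\<lambda>s. (t - s) powr (1 - 1) * h s) = integral {a..t} h"
    by (intro integral_spike[of "{t}"]) auto
  then show ?thesis
    by (simp add: RL_integral_def)
qed

text \<open>The Beta integral, moved from \<open>[0, 1]\<close> to \<open>[a, t]\<close>.\<close>

lemma has_integral_RL_kernel_powr:
  fixes \<nu> p a t :: real
  assumes "\<nu> > 0" "p > -1" "a \<le> t"
  shows "((\<lambda>s. (t - s) powr (\<nu> - 1) * (s - a) powr p) has_integral
           Beta (p + 1) \<nu> * (t - a) powr (\<nu> + p)) {a..t}"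
proof (cases "a = t")
  case True
  have "((\<lambda>s. (t - s) powr (\<nu> - 1) * (s - a) powr p) has_integral 0) (cbox t t)"
    by (rule has_integral_null) simp
  then show ?thesis
    using True by simp
next
  case False
  define L where "L = t - a"
  have L: "L > 0" using False assms by (simp add: L_def)
  have "((\<lambda>x. x powr (p + 1 - 1) * (1 - x) powr (\<nu> - 1)) has_integral Beta (p + 1) \<nu>) (cbox 0 1)"
    using has_integral_Beta_real[of "p + 1" \<nu>] assms by simp
  from has_integral_affinity'[OF this, of "1 / L" "- a / L"] L
  have "((\<lambda>s. (s / L - a / L) powr p * (1 - (s / L - a / L)) powr (\<nu> - 1)) has_integral
           Beta (p + 1) \<nu> * L) (cbox (a / L * L) ((1 + a / L) * L))"
    by (simp add: mult.commute)
  moreover have "(1 + a / L) * L = t" "a / L * L = a"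
    using L by (simp_all add: distrib_right L_def)
  ultimately have "((\<lambda>s. ((s - a) / L) powr p * (1 - (s - a) / L) powr (\<nu> - 1)) has_integral
           Beta (p + 1) \<nu> * L) {a..t}"
    by (simp only: diff_divide_distrib box_real)
  then have scaled: "((\<lambda>s. L powr (\<nu> + p - 1) * (((s - a) / L) powr p * (1 - (s - a) / L) powr (\<nu> - 1)))
               has_integral L powr (\<nu> + p - 1) * (Beta (p + 1) \<nu> * L)) {a..t}"
    by (rule has_integral_mult_right)
  have const: "L powr (\<nu> + p - 1) * (Beta (p + 1) \<nu> * L) = Beta (p + 1) \<nu> * (t - a) powr (\<nu> + p)"
    using L powr_add[of L "\<nu> + p - 1" 1] by (simp add: L_def)
  have "L powr (\<nu> + p - 1) * (((s - a) / L) powr p * (1 - (s - a) / L) powr (\<nu> - 1))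
               = (t - s) powr (\<nu> - 1) * (s - a) powr p" if "s \<in> {a..t}" for s
  proof -
    have "1 - (s - a) / L = (t - s) / L"
      using L by (simp add: field_simps L_def)
    moreover have "L powr (\<nu> + p - 1) = L powr p * L powr (\<nu> - 1)"
      by (simp add: powr_add[symmetric] algebra_simps)
    ultimately show ?thesis
      using L that by (simp add: powr_divide)
  qed
  from has_integral_eq[OF this scaled] show ?thesis
    unfolding const by simp
qed

lemma has_integral_RL_kernel:
  fixes \<nu> a t :: real
  assumes "\<nu> > 0" "a \<le> t"
  shows "((\<lambda>s. (t - s) powr (\<nu> - 1)) has_integral (t - a) powr \<nu> / \<nu>) {a..t}"
proof -
  have "\<nu> \<notin> \<int>\<^sub>\<le>\<^sub>0"
    using assms by auto
  then have "Gamma (1 + \<nu>) = \<nu> * Gamma \<nu>"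
    using Gamma_plus1[of \<nu>] by (simp add: add.commute)
  then have "Beta 1 \<nu> = 1 / \<nu>"
    using assms less_imp_neq[OF Gamma_real_pos[OF assms(1)]] by (simp add: Beta_def)
  with has_integral_RL_kernel_powr[of \<nu> 0 a t] assms
  have "((\<lambda>s. (t - s) powr (\<nu> - 1) * (s - a) powr 0) has_integral (t - a) powr \<nu> / \<nu>) {a..t}"
    by simp
  then show ?thesis
    by (rule has_integral_spike[of "{a}", rotated 2]) auto
qed

text \<open>
  For \<open>\<nu> < 1\<close> the kernel is unbounded at \<open>s = t\<close>; being nonnegative it is absolutely
  integrable, and a bounded measurable factor preserves this.
\<close>

lemma RL_kernel_integrable:
  fixes \<nu> a t :: real
  assumes "\<nu> > 0" "continuous_on {a..t} h"
  shows "(\<lambda>s. (t - s) powr (\<nu> - 1) * h s) integrable_on {a..t}"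
proof (cases "a \<le> t")
  case True
  have "(\<lambda>s. (t - s) powr (\<nu> - 1)) absolutely_integrable_on {a..t}"
    using has_integral_RL_kernel[OF assms(1), of a t] True
    by (intro nonnegative_absolutely_integrable_1) auto
  moreover have "h \<in> borel_measurable (lebesgue_on {a..t})"
    using assms(2) by (intro continuous_imp_measurable_on_sets_lebesgue) auto
  moreover have "bounded (h ` {a..t})"
    using assms(2) by (intro compact_imp_bounded compact_continuous_image) auto
  ultimately have "(\<lambda>s. h s * (t - s) powr (\<nu> - 1)) absolutely_integrable_on {a..t}"
    by (intro absolutely_integrable_bounded_measurable_product_real) auto
  then show ?thesis
    by (simp add: absolutely_integrable_on_def mult.commute)
qed auto

lemma RL_integral_cmult: "RL_integral a \<nu> (\<lambda>s. c * h s) t = c * RL_integral a \<nu> h t"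
proof -
  have "(\<lambda>s. (t - s) powr (\<nu> - 1) * (c * h s)) = (\<lambda>s. c * ((t - s) powr (\<nu> - 1) * h s))"
    by (simp add: fun_eq_iff)
  then show ?thesis
    by (simp add: RL_integral_def)
qed

lemma RL_integral_diff:
  assumes "\<nu> \<ge> 0" "continuous_on {a..b} h" "continuous_on {a..b} k" "t \<in> {a..b}"
  shows "RL_integral a \<nu> (\<lambda>s. h s - k s) t = RL_integral a \<nu> h t - RL_integral a \<nu> k t"
proof (cases "\<nu> = 0")
  case False
  have "continuous_on {a..t} h" "continuous_on {a..t} k"
    by (rule continuous_on_subset[OF assms(2)], use assms(4) in force)
       (rule continuous_on_subset[OF assms(3)], use assms(4) in force)
  then have "integral {a..t} (\<lambda>s. (t - s) powr (\<nu> - 1) * h s - (t - s) powr (\<nu> - 1) * k s)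
     = integral {a..t} (\<lambda>s. (t - s) powr (\<nu> - 1) * h s)
      - integral {a..t} (\<lambda>s. (t - s) powr (\<nu> - 1) * k s)"
    using False assms(1) by (intro Henstock_Kurzweil_Integration.integral_diff RL_kernel_integrable) auto
  then show ?thesis
    using False by (simp add: RL_integral_def right_diff_distrib diff_divide_distrib)
qed auto

lemma RL_integral_sum:
  assumes "\<nu> > 0" "finite A" "\<And>i. i \<in> A \<Longrightarrow> continuous_on {a..t} (h i)"
  shows "RL_integral a \<nu> (\<lambda>s. \<Sum>i\<in>A. h i s) t = (\<Sum>i\<in>A. RL_integral a \<nu> (h i) t)"
proof -
  have "integral {a..t} (\<lambda>s. \<Sum>i\<in>A. (t - s) powr (\<nu> - 1) * h i s)
     = (\<Sum>i\<in>A. integral {a..t} (\<lambda>s. (t - s) powr (\<nu> - 1) * h i s))"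
    using assms by (intro integral_sum RL_kernel_integrable) auto
  then show ?thesis
    using assms(1) by (simp add: RL_integral_def sum_distrib_left)
qed

text \<open>
  The bound that makes \<open>I\<^sup>\<nu>\<close> continuous in the uniform norm: \<open>\<bar>I\<^sup>\<nu> h\<bar> \<le> I\<^sup>\<nu> M\<close>.
\<close>

lemma abs_RL_integral_le:
  assumes "\<nu> > 0" "a \<le> t" "continuous_on {a..t} h" "\<And>s. s \<in> {a..t} \<Longrightarrow> \<bar>h s\<bar> \<le> M"
  shows "\<bar>RL_integral a \<nu> h t\<bar> \<le> M * ((t - a) powr \<nu> / Gamma (\<nu> + 1))"
proof -
  have int: "((\<lambda>s. M * (t - s) powr (\<nu> - 1)) has_integral M * ((t - a) powr \<nu> / \<nu>)) {a..t}"
    using assms by (intro has_integral_mult_right has_integral_RL_kernel)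
  have "norm (integral {a..t} (\<lambda>s. (t - s) powr (\<nu> - 1) * h s))
      \<le> integral {a..t} (\<lambda>s. M * (t - s) powr (\<nu> - 1))"
  proof (intro integral_norm_bound_integral RL_kernel_integrable)
    show "(\<lambda>s. M * (t - s) powr (\<nu> - 1)) integrable_on {a..t}"
      using int by blast
    show "norm ((t - s) powr (\<nu> - 1) * h s) \<le> M * (t - s) powr (\<nu> - 1)" if "s \<in> {a..t}" for s
      using assms(4)[OF that] mult_right_mono[of "\<bar>h s\<bar>" M "(t - s) powr (\<nu> - 1)"]
      by (simp add: abs_mult mult.commute)
  qed (use assms in auto)
  also have "\<dots> = M * ((t - a) powr \<nu> / \<nu>)"
    using int by (rule integral_unique)
  finally have "\<bar>integral {a..t} (\<lambda>s. (t - s) powr (\<nu> - 1) * h s)\<bar> / Gamma \<nu>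
      \<le> M * ((t - a) powr \<nu> / \<nu>) / Gamma \<nu>"
    using assms(1) by (intro divide_right_mono) (auto intro: less_imp_le Gamma_real_pos)
  moreover have "Gamma (\<nu> + 1) = \<nu> * Gamma \<nu>"
    using assms(1) by (intro Gamma_plus1) auto
  ultimately show ?thesis
    using assms(1) Gamma_real_pos[of \<nu>] by (simp add: RL_integral_def)
qed

lemma RL_integral_powr:
  assumes "\<nu> > 0" "p > -1" "a \<le> t"
  shows "RL_integral a \<nu> (\<lambda>s. (s - a) powr p) t
       = Gamma (p + 1) / Gamma (p + \<nu> + 1) * (t - a) powr (p + \<nu>)"
proof -
  have "integral {a..t} (\<lambda>s. (t - s) powr (\<nu> - 1) * (s - a) powr p)
      = Beta (p + 1) \<nu> * (t - a) powr (\<nu> + p)"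
    using assms by (intro integral_unique has_integral_RL_kernel_powr)
  moreover have "Gamma \<nu> \<noteq> 0"
    using Gamma_real_pos[OF assms(1)] by simp
  ultimately show ?thesis
    using assms(1) by (simp add: RL_integral_def Beta_def add_ac)
qed

lemma RL_integral_power:
  assumes "\<nu> > 0" "a \<le> t"
  shows "RL_integral a \<nu> (\<lambda>s. (s - a) ^ n) t
       = Gamma (real n + 1) / Gamma (real n + \<nu> + 1) * (t - a) powr (real n + \<nu>)"
proof -
  have "integral {a..t} (\<lambda>s. (t - s) powr (\<nu> - 1) * (s - a) ^ n)
      = integral {a..t} (\<lambda>s. (t - s) powr (\<nu> - 1) * (s - a) powr real n)"
    by (intro integral_spike[of "{a}"]) (auto simp: powr_realpow)
  then show ?thesis
    using assms RL_integral_powr[of \<nu> "real n" a t] by (simp add: RL_integral_def)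
qed

lemma RL_integral_const_one:
  assumes "\<nu> \<ge> 0" "a < t"
  shows "RL_integral a \<nu> (\<lambda>s. 1) t = (t - a) powr \<nu> / Gamma (\<nu> + 1)"
  using RL_integral_power[of \<nu> a t 0] assms by (cases "\<nu> = 0") auto

text \<open>
  Weierstrass approximation by polynomials centred at the base point \<open>a\<close>, for which fractional
  integrals are explicit.
\<close>

lemma polynomial_dense:
  fixes h :: "real \<Rightarrow> real"
  assumes "continuous_on {a..b} h" "e > 0"
  obtains c n where "\<And>t. t \<in> {a..b} \<Longrightarrow> \<bar>h t - (\<Sum>i\<le>n. c i * (t - a) ^ i)\<bar> \<le> e"
proof -
  have "continuous_on {0..b - a} (\<lambda>x. h (a + x))"
    by (rule continuous_on_compose2[OF assms(1)]) (auto intro!: continuous_intros)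
  then obtain g where g: "real_polynomial_function g"
    "\<And>x. x \<in> {0..b - a} \<Longrightarrow> \<bar>h (a + x) - g x\<bar> < e"
    using Stone_Weierstrass_real_polynomial_function[of "{0..b - a}"] assms(2)
    by (metis compact_Icc)
  obtain c n where c: "g = (\<lambda>x. \<Sum>i\<le>n. c i * x ^ i)"
    using g(1) by (auto simp: real_polynomial_function_iff_sum)
  show thesis
  proof (rule that)
    fix t assume "t \<in> {a..b}"
    then show "\<bar>h t - (\<Sum>i\<le>n. c i * (t - a) ^ i)\<bar> \<le> e"
      using g(2)[of "t - a"] c by simp
  qed
qed

lemma RL_integral_polynomial:
  assumes "\<nu> > 0" "a \<le> t"
  shows "RL_integral a \<nu> (\<lambda>s. \<Sum>i\<le>n. c i * (s - a) ^ i) t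
     = (\<Sum>i\<le>n. c i * (Gamma (real i + 1) / Gamma (real i + \<nu> + 1)) * (t - a) powr (real i + \<nu>))"
proof -
  have "RL_integral a \<nu> (\<lambda>s. \<Sum>i\<le>n. c i * (s - a) ^ i) t
      = (\<Sum>i\<le>n. RL_integral a \<nu> (\<lambda>s. c i * (s - a) ^ i) t)"
    using assms by (intro RL_integral_sum) (auto intro!: continuous_intros)
  then show ?thesis
    using assms by (simp add: RL_integral_cmult RL_integral_power mult.assoc)
qed

lemma abs_RL_integral_diff_le:
  assumes "\<nu> > 0" "continuous_on {a..b} h" "continuous_on {a..b} k" "t \<in> {a..b}"
    and "\<And>s. s \<in> {a..b} \<Longrightarrow> \<bar>h s - k s\<bar> \<le> e"
  shows "\<bar>RL_integral a \<nu> h t - RL_integral a \<nu> k t\<bar> \<le> e * ((b - a) powr \<nu> / Gamma (\<nu> + 1))"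
proof -
  have e: "e \<ge> 0" using assms(4) assms(5)[of t] abs_ge_zero[of "h t - k t"] by linarith
  have "continuous_on {a..t} (\<lambda>s. h s - k s)"
    by (rule continuous_on_subset[of "{a..b}"]) (use assms in \<open>auto intro: continuous_intros\<close>)
  then have "\<bar>RL_integral a \<nu> (\<lambda>s. h s - k s) t\<bar> \<le> e * ((t - a) powr \<nu> / Gamma (\<nu> + 1))"
    using assms by (intro abs_RL_integral_le) auto
  also have "\<dots> \<le> e * ((b - a) powr \<nu> / Gamma (\<nu> + 1))"
    using assms(1,4) e
    by (intro mult_left_mono divide_right_mono powr_mono2) (auto intro: less_imp_le Gamma_real_pos)
  finally show ?thesis
    using assms RL_integral_diff[of \<nu> a b h k t] by simp
qed

text \<open>\<open>I\<^sup>\<nu> h\<close> is the uniform limit of the \<open>I\<^sup>\<nu> p\<close> for polynomials \<open>p\<close> tending to \<open>h\<close>.\<close>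

lemma continuous_on_RL_integral:
  assumes "\<nu> \<ge> 0" "continuous_on {a..b} h"
  shows "continuous_on {a..b} (RL_integral a \<nu> h)"
proof (cases "\<nu> = 0")
  case True
  then show ?thesis using assms(2) by simp
next
  case False
  then have \<nu>: "\<nu> > 0" using assms by simp
  have "\<exists>c n. \<forall>t\<in>{a..b}. \<bar>h t - (\<Sum>i\<le>n. c i * (t - a) ^ i)\<bar> \<le> 1 / real (Suc N)" for N
    using polynomial_dense[OF assms(2), of "1 / real (Suc N)"] by (metis of_nat_0_less_iff zero_less_Suc zero_less_divide_1_iff)
  then obtain c n where cn: "\<And>N t. t \<in> {a..b} \<Longrightarrow>
      \<bar>h t - (\<Sum>i\<le>n N. c N i * (t - a) ^ i)\<bar> \<le> 1 / real (Suc N)"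
    by metis
  define p where "p = (\<lambda>N s. \<Sum>i\<le>n N. c N i * (s - a) ^ i)"
  define C where "C = (b - a) powr \<nu> / Gamma (\<nu> + 1)"
  show ?thesis
  proof (rule uniform_limit_theorem)
    show "\<forall>\<^sub>F N in sequentially. continuous_on {a..b} (RL_integral a \<nu> (p N))"
    proof (rule always_eventually, rule allI)
      fix N
      have "continuous_on {a..b} (\<lambda>t. \<Sum>i\<le>n N. c N i * (Gamma (real i + 1) / Gamma (real i + \<nu> + 1))
                * (t - a) powr (real i + \<nu>))"
        using \<nu> by (intro continuous_intros continuous_on_powr') auto
      then show "continuous_on {a..b} (RL_integral a \<nu> (p N))"
        using \<nu> by (simp add: p_def RL_integral_polynomial cong: continuous_on_cong_simp)
    qed
    show "uniform_limit {a..b} (\<lambda>N. RL_integral a \<nu> (p N)) (RL_integral a \<nu> h) sequentially"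
    proof (rule uniform_limitI)
      fix e :: real assume "e > 0"
      have "(\<lambda>N. 1 / real (Suc N) * C) \<longlonglongrightarrow> 0 * C"
        using LIMSEQ_inverse_real_of_nat by (intro tendsto_mult tendsto_const) (simp add: inverse_eq_divide)
      then have "\<forall>\<^sub>F N in sequentially. 1 / real (Suc N) * C < e"
        using \<open>e > 0\<close> by (intro order_tendstoD(2)[of _ "0 * C"]) auto
      then show "\<forall>\<^sub>F N in sequentially. \<forall>t\<in>{a..b}. dist (RL_integral a \<nu> (p N) t) (RL_integral a \<nu> h t) < e"
      proof eventually_elim
        case (elim N)
        have "\<bar>RL_integral a \<nu> h t - RL_integral a \<nu> (p N) t\<bar> \<le> 1 / real (Suc N) * C" if "t \<in> {a..b}" for t
          unfolding C_def using \<nu> assms that cn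
          by (intro abs_RL_integral_diff_le) (auto simp: p_def intro!: continuous_intros)
        with elim show ?case
          by (force simp: dist_real_def abs_minus_commute)
      qed
    qed
  qed auto
qed

text \<open>
  On powers, \<open>I\<^sup>\<nu>\<close> multiplies by a quotient of Gamma values, and the quotients for \<open>\<nu>\<close> and then
  \<open>\<mu>\<close> telescope to the one for \<open>\<mu> + \<nu>\<close>.
\<close>

lemma RL_integral_semigroup_polynomial:
  assumes "\<mu> > 0" "\<nu> > 0" "a \<le> t"
  shows "RL_integral a \<mu> (RL_integral a \<nu> (\<lambda>s. \<Sum>i\<le>n. c i * (s - a) ^ i)) t
       = RL_integral a (\<mu> + \<nu>) (\<lambda>s. \<Sum>i\<le>n. c i * (s - a) ^ i) t" (is "?lhs = ?rhs")
proof -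
  define d where "d = (\<lambda>i. c i * (Gamma (real i + 1) / Gamma (real i + \<nu> + 1)))"
  have "?lhs = RL_integral a \<mu> (\<lambda>s. \<Sum>i\<le>n. d i * (s - a) powr (real i + \<nu>)) t"
    unfolding d_def by (rule RL_integral_cong[of a t]) (use assms in \<open>auto simp: RL_integral_polynomial\<close>)
  also have "\<dots> = (\<Sum>i\<le>n. RL_integral a \<mu> (\<lambda>s. d i * (s - a) powr (real i + \<nu>)) t)"
    using assms by (intro RL_integral_sum) (auto intro!: continuous_intros continuous_on_powr')
  also have "\<dots> = (\<Sum>i\<le>n. d i * (Gamma (real i + \<nu> + 1) / Gamma (real i + \<nu> + \<mu> + 1)
                      * (t - a) powr (real i + \<nu> + \<mu>)))"
    using assms by (simp add: RL_integral_cmult RL_integral_powr)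
  also have "\<dots> = ?rhs"
  proof -
    have "Gamma (real i + \<nu> + 1) > 0" for i
      using assms by (intro Gamma_real_pos) auto
    then have "Gamma (real i + \<nu> + 1) \<noteq> 0" for i
      by (metis less_irrefl)
    then show ?thesis
      using assms by (simp add: RL_integral_polynomial d_def add_ac mult.assoc)
  qed
  finally show ?thesis .
qed

lemma RL_integral_semigroup:
  assumes "\<mu> \<ge> 0" "\<nu> \<ge> 0" "continuous_on {a..b} h" "t \<in> {a..b}"
  shows "RL_integral a \<mu> (RL_integral a \<nu> h) t = RL_integral a (\<mu> + \<nu>) h t"
proof (cases "\<mu> = 0 \<or> \<nu> = 0")
  case True
  then show ?thesis by auto
next
  case False
  then have pos: "\<mu> > 0" "\<nu> > 0" using assms by auto
  \<comment> \<open>If \<open>p\<close> is within \<open>e\<close> of \<open>h\<close>, replacing \<open>h\<close> by \<open>p\<close> changes the two sides together by at most \<open>C e\<close>.\<close>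
  define C where "C = (b - a) powr \<nu> / Gamma (\<nu> + 1) * ((b - a) powr \<mu> / Gamma (\<mu> + 1))
                       + (b - a) powr (\<mu> + \<nu>) / Gamma (\<mu> + \<nu> + 1)"
  have C: "C \<ge> 0"
    unfolding C_def using pos
    by (intro add_nonneg_nonneg mult_nonneg_nonneg divide_nonneg_nonneg)
       (auto intro: less_imp_le Gamma_real_pos)
  have "\<bar>RL_integral a \<mu> (RL_integral a \<nu> h) t - RL_integral a (\<mu> + \<nu>) h t\<bar> \<le> 0 + e" if "e > 0" for e
  proof -
    have "e / (C + 1) > 0" using that C by simp
    then obtain c n where cn: "\<And>t. t \<in> {a..b} \<Longrightarrow>
        \<bar>h t - (\<Sum>i\<le>n. c i * (t - a) ^ i)\<bar> \<le> e / (C + 1)"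
      using polynomial_dense[OF assms(3)] by metis
    define p where "p = (\<lambda>s. \<Sum>i\<le>n. c i * (s - a) ^ i)"
    have p: "continuous_on {a..b} p"
      unfolding p_def by (intro continuous_intros)
    have 1: "\<bar>RL_integral a \<nu> h s - RL_integral a \<nu> p s\<bar>
        \<le> e / (C + 1) * ((b - a) powr \<nu> / Gamma (\<nu> + 1))" if "s \<in> {a..b}" for s
      using that pos assms p cn by (intro abs_RL_integral_diff_le) (auto simp: p_def)
    have 2: "\<bar>RL_integral a \<mu> (RL_integral a \<nu> h) t - RL_integral a \<mu> (RL_integral a \<nu> p) t\<bar>
        \<le> e / (C + 1) * ((b - a) powr \<nu> / Gamma (\<nu> + 1)) * ((b - a) powr \<mu> / Gamma (\<mu> + 1))"
      by (rule abs_RL_integral_diff_le[OF pos(1) _ _ assms(4) 1])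
         (use pos assms p in \<open>auto intro: continuous_on_RL_integral\<close>)
    have 3: "\<bar>RL_integral a (\<mu> + \<nu>) h t - RL_integral a (\<mu> + \<nu>) p t\<bar>
        \<le> e / (C + 1) * ((b - a) powr (\<mu> + \<nu>) / Gamma (\<mu> + \<nu> + 1))"
      using pos assms p cn by (intro abs_RL_integral_diff_le) (auto simp: p_def)
    have 4: "RL_integral a \<mu> (RL_integral a \<nu> p) t = RL_integral a (\<mu> + \<nu>) p t"
      unfolding p_def using pos assms by (intro RL_integral_semigroup_polynomial) auto
    have "\<bar>RL_integral a \<mu> (RL_integral a \<nu> h) t - RL_integral a (\<mu> + \<nu>) h t\<bar>
        \<le> e / (C + 1) * ((b - a) powr \<nu> / Gamma (\<nu> + 1)) * ((b - a) powr \<mu> / Gamma (\<mu> + 1))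
          + e / (C + 1) * ((b - a) powr (\<mu> + \<nu>) / Gamma (\<mu> + \<nu> + 1))"
      using 2 3 4 by linarith
    also have "\<dots> = e / (C + 1) * C"
      by (simp add: C_def distrib_left mult.assoc)
    also have "\<dots> \<le> e"
      using C that by (simp add: field_simps)
    finally show ?thesis by simp
  qed
  then have "\<bar>RL_integral a \<mu> (RL_integral a \<nu> h) t - RL_integral a (\<mu> + \<nu>) h t\<bar> \<le> 0"
    by (rule field_le_epsilon)
  then show ?thesis by simp
qed

lemma RL_integral_has_vector_derivative:
  assumes "\<nu> \<ge> 0" "continuous_on {a..b} h" "t \<in> {a..b}"
  shows "(RL_integral a (\<nu> + 1) h has_vector_derivative RL_integral a \<nu> h t) (at t within {a..b})"
proof (rule has_vector_derivative_transform[OF assms(3)])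
  show "((\<lambda>t. integral {a..t} (RL_integral a \<nu> h)) has_vector_derivative RL_integral a \<nu> h t)
          (at t within {a..b})"
    using assms by (intro integral_has_vector_derivative continuous_on_RL_integral)
  show "RL_integral a (\<nu> + 1) h s = integral {a..s} (RL_integral a \<nu> h)" if "s \<in> {a..b}" for s
    using RL_integral_semigroup[of 1 \<nu> a b h s] assms that by (simp add: RL_integral_one add.commute)
qed

text \<open>
  Applying \<open>I\<^bsup>1-\<nu>\<^esup>\<close> turns equality of \<open>I\<^sup>\<nu> h\<close> and \<open>I\<^sup>\<nu> k\<close> into equality of the ordinary
  primitives of \<open>h\<close> and \<open>k\<close>, which can be differentiated.
\<close>

lemma RL_integral_inject:
  assumes "a < b" "0 \<le> \<nu>" "\<nu> \<le> 1" "continuous_on {a..b} h" "continuous_on {a..b} k"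
    and eq: "\<And>t. t \<in> {a..b} \<Longrightarrow> RL_integral a \<nu> h t = RL_integral a \<nu> k t"
    and t: "t \<in> {a..b}"
  shows "h t = k t"
proof -
  have eq1: "RL_integral a 1 h s = RL_integral a 1 k s" if "s \<in> {a..b}" for s
  proof -
    have "RL_integral a 1 h s = RL_integral a (1 - \<nu>) (RL_integral a \<nu> h) s"
      using RL_integral_semigroup[of "1 - \<nu>" \<nu> a b h s] assms that by simp
    also have "\<dots> = RL_integral a (1 - \<nu>) (RL_integral a \<nu> k) s"
      using eq that by (rule RL_integral_cong)
    also have "\<dots> = RL_integral a 1 k s"
      using RL_integral_semigroup[of "1 - \<nu>" \<nu> a b k s] assms that by simp
    finally show ?thesis .
  qed
  have hd: "(RL_integral a 1 h has_vector_derivative h t) (at t within {a..b})"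
    using RL_integral_has_vector_derivative[of 0 a b h t] assms by simp
  have "(RL_integral a 1 k has_vector_derivative k t) (at t within {a..b})"
    using RL_integral_has_vector_derivative[of 0 a b k t] assms by simp
  then have "(RL_integral a 1 h has_vector_derivative k t) (at t within {a..b})"
    by (rule has_vector_derivative_transform[OF t eq1, rotated])
  with hd show ?thesis
    using vector_derivative_within_closed_interval[OF assms(1) t] by metis
qed

section \<open>Inverting the fractional differential equation\<close>

text \<open>
  \<open>I\<^sup>2 g\<close> is a second primitive of \<open>g\<close>, so \<open>w'' = -g\<close> holds exactly when \<open>w + I\<^sup>2 g\<close> is affine.
\<close>

lemma second_derivative_iff:
  assumes "a < b" "continuous_on {a..b} g"
  shows "(\<forall>t\<in>{a..b}. nth_differentiable_within 2 {a..b} w t \<and> nth_deriv_within 2 {a..b} w t + g t = 0)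
     \<longleftrightarrow> (\<exists>c d. \<forall>t\<in>{a..b}. w t = d + c * (t - a) - RL_integral a 2 g t)"  (is "?ode \<longleftrightarrow> ?rep")
proof -
  define S where "S = {a..b}"
  define w' where "w' = (\<lambda>t. vector_derivative w (at t within S))"
  have vd: "vector_derivative f (at t within S) = y"
    if "(f has_vector_derivative y) (at t within S)" "t \<in> S" for f :: "real \<Rightarrow> real" and y t
    using vector_derivative_within_closed_interval[OF assms(1)] that by (simp add: S_def)
  have I2: "(RL_integral a 2 g has_vector_derivative RL_integral a 1 g t) (at t within S)" if "t \<in> S" for t
    using RL_integral_has_vector_derivative[of 1 a b g t] assms that by (simp add: S_def)
  have I1: "(RL_integral a 1 g has_vector_derivative g t) (at t within S)" if "t \<in> S" for t
    using RL_integral_has_vector_derivative[of 0 a b g t] assms that by (simp add: S_def)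
  have ode: "?ode \<longleftrightarrow> (\<forall>t\<in>S. (w has_vector_derivative w' t) (at t within S)
                       \<and> (w' has_vector_derivative - g t) (at t within S))" (is "_ \<longleftrightarrow> ?ode'")
  proof
    assume ?ode
    then have "w differentiable (at t within S) \<and> w' differentiable (at t within S)
        \<and> vector_derivative w' (at t within S) = - g t" if "t \<in> S" for t
      using that
      by (auto simp: numeral_2_eq_2 S_def[symmetric] w'_def eq_neg_iff_add_eq_0 dest!: eventually_nhds_x_imp_x)
    then show ?ode'
      unfolding w'_def by (metis vector_derivative_works)
  next
    assume *: ?ode'
    then have "w differentiable (at t within S) \<and> w' differentiable (at t within S)
        \<and> vector_derivative w' (at t within S) = - g t" if "t \<in> S" for t
      using that vd by (meson differentiableI_vector)
    then show ?ode
      by (auto simp: numeral_2_eq_2 S_def[symmetric] w'_def[symmetric])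
  qed
  show ?thesis
    unfolding ode
  proof
    assume *: ?ode'
    have "\<exists>c. \<forall>t\<in>S. w' t + RL_integral a 1 g t = c"
    proof (rule has_vector_derivative_zero_constant[of S])
      fix t assume "t \<in> S"
      with * I1 have "((\<lambda>t. w' t + RL_integral a 1 g t) has_vector_derivative - g t + g t) (at t within S)"
        by (intro has_vector_derivative_add) auto
      then show "((\<lambda>t. w' t + RL_integral a 1 g t) has_vector_derivative 0) (at t within S)"
        by simp
    qed (auto simp: S_def)
    then obtain c where c: "\<And>t. t \<in> S \<Longrightarrow> w' t + RL_integral a 1 g t = c" by blast
    have "\<exists>d. \<forall>t\<in>S. w t + RL_integral a 2 g t - c * (t - a) = d"
    proof (rule has_vector_derivative_zero_constant[of S])
      fix t assume t: "t \<in> S"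
      have "((\<lambda>t. w t + RL_integral a 2 g t - c * (t - a)) has_vector_derivative
               w' t + RL_integral a 1 g t - c * (1 - 0)) (at t within S)"
        using * I2 t by (intro derivative_intros has_vector_derivative_mult_right) auto
      then show "((\<lambda>t. w t + RL_integral a 2 g t - c * (t - a)) has_vector_derivative 0) (at t within S)"
        using c[OF t] by simp
    qed (auto simp: S_def)
    then obtain d where "\<And>t. t \<in> S \<Longrightarrow> w t + RL_integral a 2 g t - c * (t - a) = d" by blast
    then have "\<forall>t\<in>S. w t = d + c * (t - a) - RL_integral a 2 g t" by force
    then show ?rep unfolding S_def by blast
  next
    assume ?rep
    then obtain c d where cd: "\<And>t. t \<in> S \<Longrightarrow> w t = d + c * (t - a) - RL_integral a 2 g t"
      unfolding S_def by blast
    have hw: "(w has_vector_derivative c - RL_integral a 1 g t) (at t within S)" if t: "t \<in> S" for t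
    proof (rule has_vector_derivative_transform[OF t cd])
      have "((\<lambda>t. d + c * (t - a) - RL_integral a 2 g t) has_vector_derivative
              0 + c * (1 - 0) - RL_integral a 1 g t) (at t within S)"
        using I2 t by (intro derivative_intros has_vector_derivative_mult_right) auto
      then show "((\<lambda>t. d + c * (t - a) - RL_integral a 2 g t) has_vector_derivative
              c - RL_integral a 1 g t) (at t within S)" by simp
    qed
    then have w': "w' t = c - RL_integral a 1 g t" if "t \<in> S" for t
      using vd that unfolding w'_def by blast
    have "(w' has_vector_derivative - g t) (at t within S)" if t: "t \<in> S" for t
    proof (rule has_vector_derivative_transform[OF t w'])
      have "((\<lambda>t. c - RL_integral a 1 g t) has_vector_derivative 0 - g t) (at t within S)"
        using I1 t by (intro derivative_intros) auto
      then show "((\<lambda>t. c - RL_integral a 1 g t) has_vector_derivative - g t) (at t within S)"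
        by simp
    qed
    with hw w' show ?ode' by simp
  qed
qed

text \<open>
  The affine function in \<open>I\<^bsup>2-\<alpha>\<^esup> u = d + c (t - a) - I\<^sup>2 g\<close> has \<open>d = 0\<close>, since the left side and
  \<open>I\<^sup>2 g\<close> vanish at \<open>a\<close>: for \<open>\<alpha> < 2\<close> an integral over a point, for \<open>\<alpha> = 2\<close> by \<open>u(a) = 0\<close>. What is
  left is \<open>I\<^bsup>2-\<alpha>\<^esup>\<close> of the right side claimed for \<open>u\<close>, and \<open>I\<^bsup>2-\<alpha>\<^esup>\<close> is injective.
\<close>

lemma fractional_ode_iff:
  assumes "a < b" "1 < \<alpha>" "\<alpha> \<le> 2" "continuous_on {a..b} g" "continuous_on {a..b} u"
  shows "(\<forall>t\<in>{a..b}. RL_differentiable a b \<alpha> u t \<and> RL_deriv a b \<alpha> u t + g t = 0) \<and> u a = 0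
     \<longleftrightarrow> (\<exists>c. \<forall>t\<in>{a..b}. u t = c * RL_integral a (\<alpha> - 1) (\<lambda>_. 1) t - RL_integral a \<alpha> g t)"
    (is "?ode \<and> _ \<longleftrightarrow> ?rep")
proof -
  have n: "nat \<lceil>\<alpha>\<rceil> = 2"
    using ceiling_unique[of 2 \<alpha>] assms by simp
  define k where "k = (\<lambda>c t. c * RL_integral a (\<alpha> - 1) (\<lambda>_. 1) t - RL_integral a \<alpha> g t)"
  have cont: "continuous_on {a..b} (k c)" for c
    unfolding k_def using assms by (intro continuous_intros continuous_on_RL_integral) auto
  have Ik: "RL_integral a (2 - \<alpha>) (k c) t = c * (t - a) - RL_integral a 2 g t" if t: "t \<in> {a..b}" for c t
  proof -
    have "RL_integral a (2 - \<alpha>) (k c) t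
        = c * RL_integral a (2 - \<alpha>) (RL_integral a (\<alpha> - 1) (\<lambda>_. 1)) t
          - RL_integral a (2 - \<alpha>) (RL_integral a \<alpha> g) t"
      unfolding k_def using assms t
      by (subst RL_integral_diff[where b = b])
         (auto simp: RL_integral_cmult intro!: continuous_intros continuous_on_RL_integral)
    also have "RL_integral a (2 - \<alpha>) (RL_integral a (\<alpha> - 1) (\<lambda>_. 1)) t = RL_integral a 1 (\<lambda>_. 1) t"
      using RL_integral_semigroup[of "2 - \<alpha>" "\<alpha> - 1" a b "\<lambda>_. 1" t] assms t by simp
    also have "RL_integral a (2 - \<alpha>) (RL_integral a \<alpha> g) t = RL_integral a 2 g t"
      using RL_integral_semigroup[of "2 - \<alpha>" \<alpha> a b g t] assms t by simp
    finally show ?thesis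
      using t by (simp add: RL_integral_one)
  qed
  have ode: "?ode \<longleftrightarrow> (\<exists>c d. \<forall>t\<in>{a..b}. RL_integral a (2 - \<alpha>) u t = d + c * (t - a) - RL_integral a 2 g t)"
    unfolding second_derivative_iff[OF assms(1,4), symmetric]
    by (simp add: RL_differentiable_def RL_deriv_def n)
  show ?thesis
  proof
    assume L: "?ode \<and> u a = 0"
    then obtain c d where cd: "\<And>t. t \<in> {a..b} \<Longrightarrow>
        RL_integral a (2 - \<alpha>) u t = d + c * (t - a) - RL_integral a 2 g t"
      unfolding ode by blast
    have "RL_integral a (2 - \<alpha>) u a = 0"
      using L by (cases "\<alpha> = 2") (auto simp: RL_integral_start)
    with cd[of a] assms(1) have "d = 0"
      by (simp add: RL_integral_start)
    then have "RL_integral a (2 - \<alpha>) u t = RL_integral a (2 - \<alpha>) (k c) t" if "t \<in> {a..b}" for t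
      using cd Ik that by simp
    then have "u t = k c t" if "t \<in> {a..b}" for t
      using assms cont that by (intro RL_integral_inject[of a b "2 - \<alpha>" u "k c" t]) auto
    then show ?rep
      unfolding k_def by blast
  next
    assume ?rep
    then obtain c where c: "\<And>t. t \<in> {a..b} \<Longrightarrow> u t = k c t"
      unfolding k_def by blast
    have "RL_integral a (2 - \<alpha>) u t = 0 + c * (t - a) - RL_integral a 2 g t" if "t \<in> {a..b}" for t
      using RL_integral_cong[of a b u "k c", OF c that] Ik[OF that] that by simp
    moreover have "u a = 0"
      using c[of a] assms by (simp add: k_def RL_integral_start)
    ultimately show "?ode \<and> u a = 0"
      unfolding ode by blast
  qed
qed

text \<open>
  For \<open>0 < \<beta> \<le> 1\<close> the derivative of order \<open>\<beta>\<close> is the first derivative of \<open>I\<^bsup>1-\<beta>\<^esup> u\<close>, and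
  \<open>I\<^bsup>1-\<beta>\<^esup>\<close> raises the orders \<open>\<alpha> - 1\<close> and \<open>\<alpha>\<close> in \<open>u\<close> to \<open>\<alpha> - \<beta>\<close> and \<open>\<alpha> - \<beta> + 1\<close>, which the
  derivative lowers by one. The result is also right for \<open>\<beta> = 0\<close>.
\<close>

lemma fractional_boundary_derivative:
  assumes "a < b" "1 < \<alpha>" "0 \<le> \<beta>" "\<beta> \<le> 1" "\<beta> \<le> \<alpha> - 1" "continuous_on {a..b} g"
    and u: "\<And>t. t \<in> {a..b} \<Longrightarrow> u t = c * RL_integral a (\<alpha> - 1) (\<lambda>_. 1) t - RL_integral a \<alpha> g t"
  shows "RL_differentiable a b \<beta> u b"
    and "RL_deriv a b \<beta> u b
       = c * RL_integral a (\<alpha> - \<beta> - 1) (\<lambda>_. 1) b - RL_integral a (\<alpha> - \<beta>) g b"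
proof -
  have *: "RL_differentiable a b \<beta> u b \<and> RL_deriv a b \<beta> u b
       = c * RL_integral a (\<alpha> - \<beta> - 1) (\<lambda>_. 1) b - RL_integral a (\<alpha> - \<beta>) g b"
  proof (cases "\<beta> = 0")
    case True
    then show ?thesis
      using u[of b] assms(1) by (simp add: RL_differentiable_def RL_deriv_def)
  next
    case False
    have n: "nat \<lceil>\<beta>\<rceil> = 1"
      using ceiling_unique[of 1 \<beta>] assms False by simp
    have I: "RL_integral a (1 - \<beta>) u t
        = c * RL_integral a (\<alpha> - \<beta> - 1 + 1) (\<lambda>_. 1) t - RL_integral a (\<alpha> - \<beta> + 1) g t"
      if t: "t \<in> {a..b}" for t
    proof -
      have "RL_integral a (1 - \<beta>) u t
          = RL_integral a (1 - \<beta>) (\<lambda>t. c * RL_integral a (\<alpha> - 1) (\<lambda>_. 1) t - RL_integral a \<alpha> g t) t"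
        using u t by (rule RL_integral_cong)
      also have "\<dots> = c * RL_integral a (1 - \<beta>) (RL_integral a (\<alpha> - 1) (\<lambda>_. 1)) t
          - RL_integral a (1 - \<beta>) (RL_integral a \<alpha> g) t"
        using assms t
        by (subst RL_integral_diff[where b = b])
           (auto simp: RL_integral_cmult intro!: continuous_intros continuous_on_RL_integral)
      also have "RL_integral a (1 - \<beta>) (RL_integral a (\<alpha> - 1) (\<lambda>_. 1)) t
          = RL_integral a (\<alpha> - \<beta> - 1 + 1) (\<lambda>_. 1) t"
        using RL_integral_semigroup[of "1 - \<beta>" "\<alpha> - 1" a b "\<lambda>_. 1" t] assms t by (simp add: algebra_simps)
      also have "RL_integral a (1 - \<beta>) (RL_integral a \<alpha> g) t = RL_integral a (\<alpha> - \<beta> + 1) g t"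
        using RL_integral_semigroup[of "1 - \<beta>" \<alpha> a b g t] assms t by (simp add: algebra_simps)
      finally show ?thesis .
    qed
    have b: "b \<in> {a..b}" using assms(1) by simp
    have D: "(RL_integral a (1 - \<beta>) u has_vector_derivative
       c * RL_integral a (\<alpha> - \<beta> - 1) (\<lambda>_. 1) b - RL_integral a (\<alpha> - \<beta>) g b) (at b within {a..b})"
    proof (rule has_vector_derivative_transform[OF b I])
      show "((\<lambda>t. c * RL_integral a (\<alpha> - \<beta> - 1 + 1) (\<lambda>_. 1) t - RL_integral a (\<alpha> - \<beta> + 1) g t)
        has_vector_derivative c * RL_integral a (\<alpha> - \<beta> - 1) (\<lambda>_. 1) b - RL_integral a (\<alpha> - \<beta>) g b)
        (at b within {a..b})"
        using assms b
        by (intro has_vector_derivative_diff has_vector_derivative_mult_right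
              RL_integral_has_vector_derivative) auto
    qed
    then show ?thesis
      using vector_derivative_within_closed_interval[OF assms(1) b D]
      by (auto simp: RL_differentiable_def RL_deriv_def n intro: differentiableI_vector)
  qed
  then show "RL_differentiable a b \<beta> u b"
    and "RL_deriv a b \<beta> u b
       = c * RL_integral a (\<alpha> - \<beta> - 1) (\<lambda>_. 1) b - RL_integral a (\<alpha> - \<beta>) g b"
    by auto
qed

section \<open>The Green operator\<close>

text \<open>
  The solution operator of the linear problem \<open>D\<^sup>\<alpha> u + g = 0\<close> with the same boundary conditions,
  that is, integration of \<open>g\<close> against the Green function
  \<open>((t-a)\<^bsup>\<alpha>-1\<^esup> (b-s)\<^bsup>\<alpha>-\<beta>-1\<^esup> / (b-a)\<^bsup>\<alpha>-\<beta>-1\<^esup> - (t-s)\<^bsup>\<alpha>-1\<^esup>) / \<Gamma>(\<alpha>)\<close>, where the last power is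
  dropped for \<open>s > t\<close>. Keeping it in terms of fractional integrals lets the semigroup law apply.
\<close>

definition green_op :: "real \<Rightarrow> real \<Rightarrow> real \<Rightarrow> real \<Rightarrow> (real \<Rightarrow> real) \<Rightarrow> real \<Rightarrow> real" where
  "green_op a b \<alpha> \<beta> g t =
     RL_integral a (\<alpha> - \<beta>) g b / RL_integral a (\<alpha> - \<beta> - 1) (\<lambda>_. 1) b
       * RL_integral a (\<alpha> - 1) (\<lambda>_. 1) t - RL_integral a \<alpha> g t"

lemma continuous_on_superposition:
  assumes "continuous_on (S \<times> UNIV) (\<lambda>(t, x). f t x)" "continuous_on S u"
  shows "continuous_on S (\<lambda>s. f s (u s))"
proof -
  have "continuous_on S (\<lambda>s. (s, u s))"
    using assms(2) by (intro continuous_intros)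
  then show ?thesis
    using continuous_on_compose2[OF assms(1), of S "\<lambda>s. (s, u s)"] by auto
qed

lemma is_BVP_solution_iff_green_op:
  assumes "a < b" "1 < \<alpha>" "\<alpha> \<le> 2" "0 \<le> \<beta>" "\<beta> \<le> \<alpha> - 1"
    and "continuous_on ({a..b} \<times> UNIV) (\<lambda>(t, x). f t x)"
  shows "is_BVP_solution a b \<alpha> \<beta> f u \<longleftrightarrow>
     continuous_on {a..b} u \<and> (\<forall>t\<in>{a..b}. u t = green_op a b \<alpha> \<beta> (\<lambda>s. f s (u s)) t)"
proof (cases "continuous_on {a..b} u")
  case True
  define g where "g = (\<lambda>s. f s (u s))"
  have g: "continuous_on {a..b} g"
    unfolding g_def using assms(6) True by (rule continuous_on_superposition)
  \<comment> \<open>The coefficient of \<open>c\<close> in the condition at \<open>b\<close> does not vanish, so that condition determines \<open>c\<close>.\<close>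
  have pos: "RL_integral a (\<alpha> - \<beta> - 1) (\<lambda>_. 1) b > 0"
    using assms RL_integral_const_one[of "\<alpha> - \<beta> - 1" a b] Gamma_real_pos[of "\<alpha> - \<beta>"] by simp
  note bd = fractional_boundary_derivative[OF assms(1,2,4) _ assms(5) g, of u]
  show ?thesis
  proof
    assume "is_BVP_solution a b \<alpha> \<beta> f u"
    then have sol: "\<forall>t\<in>{a..b}. RL_differentiable a b \<alpha> u t \<and> RL_deriv a b \<alpha> u t + g t = 0" "u a = 0"
      "RL_deriv a b \<beta> u b = 0"
      by (auto simp: is_BVP_solution_def g_def)
    then obtain c where c: "\<And>t. t \<in> {a..b} \<Longrightarrow>
        u t = c * RL_integral a (\<alpha> - 1) (\<lambda>_. 1) t - RL_integral a \<alpha> g t"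
      using fractional_ode_iff[OF assms(1-3) g True] by blast
    have "c * RL_integral a (\<alpha> - \<beta> - 1) (\<lambda>_. 1) b = RL_integral a (\<alpha> - \<beta>) g b"
      using bd(2)[OF _ c] assms sol(3) by simp
    then have "c = RL_integral a (\<alpha> - \<beta>) g b / RL_integral a (\<alpha> - \<beta> - 1) (\<lambda>_. 1) b"
      using pos by (simp add: field_simps)
    with c True show "continuous_on {a..b} u \<and> (\<forall>t\<in>{a..b}. u t = green_op a b \<alpha> \<beta> (\<lambda>s. f s (u s)) t)"
      by (simp add: green_op_def g_def)
  next
    assume R: "continuous_on {a..b} u \<and> (\<forall>t\<in>{a..b}. u t = green_op a b \<alpha> \<beta> (\<lambda>s. f s (u s)) t)"
    define c where "c = RL_integral a (\<alpha> - \<beta>) g b / RL_integral a (\<alpha> - \<beta> - 1) (\<lambda>_. 1) b"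
    have c: "u t = c * RL_integral a (\<alpha> - 1) (\<lambda>_. 1) t - RL_integral a \<alpha> g t" if "t \<in> {a..b}" for t
      using R that by (simp add: green_op_def g_def c_def)
    have "RL_differentiable a b \<beta> u b" "RL_deriv a b \<beta> u b = 0"
      using bd[OF _ c] assms pos by (simp_all add: c_def)
    moreover have "(\<forall>t\<in>{a..b}. RL_differentiable a b \<alpha> u t \<and> RL_deriv a b \<alpha> u t + g t = 0) \<and> u a = 0"
      using fractional_ode_iff[OF assms(1-3) g True] c by blast
    ultimately show "is_BVP_solution a b \<alpha> \<beta> f u"
      using True by (auto simp: is_BVP_solution_def g_def)
  qed
qed (simp add: is_BVP_solution_def)

lemma green_op_diff:
  assumes "a < b" "1 < \<alpha>" "\<beta> \<le> \<alpha> - 1" "continuous_on {a..b} g" "continuous_on {a..b} h" "t \<in> {a..b}"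
  shows "green_op a b \<alpha> \<beta> (\<lambda>s. g s - h s) t = green_op a b \<alpha> \<beta> g t - green_op a b \<alpha> \<beta> h t"
  using assms RL_integral_diff[of \<alpha> a b g h t] RL_integral_diff[of "\<alpha> - \<beta>" a b g h b]
  by (simp add: green_op_def diff_divide_distrib left_diff_distrib)

lemma green_op_cmult: "green_op a b \<alpha> \<beta> (\<lambda>s. c * g s) t = c * green_op a b \<alpha> \<beta> g t"
  by (simp add: green_op_def RL_integral_cmult algebra_simps)

lemma continuous_on_green_op:
  assumes "1 < \<alpha>" "continuous_on {a..b} g"
  shows "continuous_on {a..b} (green_op a b \<alpha> \<beta> g)"
  unfolding green_op_def[abs_def]
  using assms by (intro continuous_intros continuous_on_RL_integral) auto

text \<open>
  Dividing by \<open>(t-a)\<^sup>\<gamma>\<close> leaves \<open>x\<^sup>\<gamma> \<le> y\<^sup>\<delta>\<close> for the ratios \<open>x = (t-s)/(t-a)\<close> and \<open>y = (b-s)/(b-a)\<close>.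
  The ratio grows with the right end point, so \<open>x \<le> y\<close>, and \<open>x\<^sup>\<gamma> \<le> x\<^sup>\<delta>\<close> because \<open>x \<le> 1\<close>.
\<close>

lemma green_kernel_nonneg:
  fixes a b s t \<alpha> \<delta> :: real
  assumes "a < t" "t \<le> b" "a \<le> s" "s \<le> t" "0 \<le> \<delta>" "\<delta> \<le> \<gamma>"
  shows "(t - s) powr \<gamma> \<le> (t - a) powr \<gamma> / (b - a) powr \<delta> * (b - s) powr \<delta>"
proof (cases "s = t")
  case False
  define x where "x = (t - s) / (t - a)"
  define y where "y = (b - s) / (b - a)"
  have x: "0 < x" "x \<le> 1" using assms False by (auto simp: x_def)
  have "(t - s) * (b - a) \<le> (b - s) * (t - a)"
  proof -
    have "0 \<le> (b - t) * (s - a)" using assms by simp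
    then show ?thesis by (simp add: algebra_simps)
  qed
  then have "x \<le> y"
    using assms by (simp add: x_def y_def field_simps)
  have "(t - s) powr \<gamma> = (t - a) powr \<gamma> * x powr \<gamma>"
    using assms by (simp add: x_def powr_divide)
  also have "\<dots> \<le> (t - a) powr \<gamma> * x powr \<delta>"
    using x assms by (intro mult_left_mono powr_mono') auto
  also have "\<dots> \<le> (t - a) powr \<gamma> * y powr \<delta>"
    using x \<open>x \<le> y\<close> assms by (intro mult_left_mono powr_mono2) auto
  also have "\<dots> = (t - a) powr \<gamma> / (b - a) powr \<delta> * (b - s) powr \<delta>"
    using assms by (simp add: y_def powr_divide)
  finally show ?thesis .
qed auto

text \<open>
  Over \<open>[t, b]\<close> only the positive term of the Green function is present, and over \<open>[a, t]\<close> it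
  dominates the other one by the kernel inequality.
\<close>

lemma green_op_nonneg:
  assumes "a < b" "1 < \<alpha>" "0 \<le> \<beta>" "\<beta> \<le> \<alpha> - 1" "continuous_on {a..b} h"
    and h: "\<And>s. s \<in> {a..b} \<Longrightarrow> h s \<ge> 0" and t: "t \<in> {a..b}"
  shows "green_op a b \<alpha> \<beta> h t \<ge> 0"
proof (cases "t = a")
  case True
  then show ?thesis using assms by (simp add: green_op_def RL_integral_start)
next
  case False
  then have at: "a < t" "t \<le> b" using t by auto
  define \<delta> where "\<delta> = \<alpha> - \<beta> - 1"
  define A where "A = (t - a) powr (\<alpha> - 1) / (b - a) powr \<delta>"
  have \<delta>: "0 \<le> \<delta>" "\<delta> \<le> \<alpha> - 1" "\<alpha> - \<beta> = \<delta> + 1" using assms by (auto simp: \<delta>_def)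
  have ht: "continuous_on {a..t} h"
    by (rule continuous_on_subset[OF assms(5)]) (use at in auto)
  have A: "A \<ge> 0" by (simp add: A_def)
  have int_b: "(\<lambda>s. (b - s) powr \<delta> * h s) integrable_on {a..b}"
    using RL_kernel_integrable[of "\<delta> + 1" a b h] \<delta> assms by simp
  then have int_bt: "(\<lambda>s. (b - s) powr \<delta> * h s) integrable_on {a..t}"
    by (rule integrable_on_subinterval) (use at in auto)
  have "integral {a..t} (\<lambda>s. (t - s) powr (\<alpha> - 1) * h s)
      \<le> integral {a..t} (\<lambda>s. A * ((b - s) powr \<delta> * h s))"
  proof (rule integral_le)
    show "(\<lambda>s. (t - s) powr (\<alpha> - 1) * h s) integrable_on {a..t}"
      using ht assms by (intro RL_kernel_integrable) auto
    show "(\<lambda>s. A * ((b - s) powr \<delta> * h s)) integrable_on {a..t}"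
      using int_bt by (rule integrable_on_mult_right)
    show "(t - s) powr (\<alpha> - 1) * h s \<le> A * ((b - s) powr \<delta> * h s)" if "s \<in> {a..t}" for s
      using mult_right_mono[OF green_kernel_nonneg[of a t b s \<delta> "\<alpha> - 1"], of "h s"] that at \<delta> h[of s]
      by (simp add: A_def mult.assoc)
  qed
  also have "\<dots> = A * integral {a..t} (\<lambda>s. (b - s) powr \<delta> * h s)"
    by simp
  also have "\<dots> \<le> A * integral {a..b} (\<lambda>s. (b - s) powr \<delta> * h s)"
    using A int_b int_bt at h by (intro mult_left_mono integral_subset_le) auto
  finally have le: "integral {a..t} (\<lambda>s. (t - s) powr (\<alpha> - 1) * h s)
      \<le> A * integral {a..b} (\<lambda>s. (b - s) powr \<delta> * h s)" .
  have G: "Gamma (\<delta> + 1) > 0" "Gamma \<alpha> > 0"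
    using \<delta> assms by (auto intro!: Gamma_real_pos)
  have "green_op a b \<alpha> \<beta> h t = (A * integral {a..b} (\<lambda>s. (b - s) powr \<delta> * h s)
        - integral {a..t} (\<lambda>s. (t - s) powr (\<alpha> - 1) * h s)) / Gamma \<alpha>"
  proof -
    have 1: "RL_integral a (\<delta> + 1) h b = integral {a..b} (\<lambda>s. (b - s) powr \<delta> * h s) / Gamma (\<delta> + 1)"
      using \<delta> by (simp add: RL_integral_def)
    have 2: "RL_integral a \<delta> (\<lambda>_. 1) b = (b - a) powr \<delta> / Gamma (\<delta> + 1)"
      using \<delta> assms by (intro RL_integral_const_one) auto
    have 3: "RL_integral a (\<alpha> - 1) (\<lambda>_. 1) t = (t - a) powr (\<alpha> - 1) / Gamma \<alpha>"
      using RL_integral_const_one[of "\<alpha> - 1" a t] assms at by simp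
    have 4: "RL_integral a \<alpha> h t = integral {a..t} (\<lambda>s. (t - s) powr (\<alpha> - 1) * h s) / Gamma \<alpha>"
      using assms by (simp add: RL_integral_def)
    show ?thesis
      unfolding green_op_def \<delta>(3) add_diff_cancel_right' 1 2 3 4
      using G by (simp add: A_def diff_divide_distrib)
  qed
  with le G show ?thesis by simp
qed

text \<open>Positivity applied to \<open>M - h\<close> and \<open>M + h\<close>.\<close>

lemma abs_green_op_le:
  assumes "a < b" "1 < \<alpha>" "0 \<le> \<beta>" "\<beta> \<le> \<alpha> - 1" "continuous_on {a..b} h"
    and h: "\<And>s. s \<in> {a..b} \<Longrightarrow> \<bar>h s\<bar> \<le> M" and t: "t \<in> {a..b}"
  shows "\<bar>green_op a b \<alpha> \<beta> h t\<bar> \<le> M * green_op a b \<alpha> \<beta> (\<lambda>_. 1) t"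
proof -
  have const: "green_op a b \<alpha> \<beta> (\<lambda>s. c) t = c * green_op a b \<alpha> \<beta> (\<lambda>_. 1) t" for c
    using green_op_cmult[of a b \<alpha> \<beta> c "\<lambda>_. 1" t] by simp
  have "green_op a b \<alpha> \<beta> (\<lambda>s. M - h s) t \<ge> 0"
    using assms(1-5) t abs_le_D1[OF h] by (intro green_op_nonneg) (auto intro!: continuous_intros)
  moreover have "green_op a b \<alpha> \<beta> (\<lambda>s. h s - (- M)) t \<ge> 0"
    using assms(1-5) t abs_le_D2[OF h]
    by (intro green_op_nonneg) (force intro!: continuous_intros)+
  ultimately show ?thesis
    using assms by (simp add: green_op_diff const[of M] const[of "- M"] del: diff_minus_eq_add)
qed

text \<open>
  The left side is maximal at \<open>x = (\<alpha> - 1) A\<close>. In the scaled quantities \<open>y\<close> and \<open>z\<close>, both equal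
  to \<open>1\<close> at the maximum, the claim is \<open>y\<^bsup>\<alpha>-1\<^esup> z \<le> 1\<close>, a weighted arithmetic-geometric mean
  inequality; it follows from \<open>ln y \<le> y - 1\<close>, since \<open>(\<alpha>-1)(y-1) + (z-1) = 0\<close>.
\<close>

lemma powr_times_linear_le:
  fixes x A \<alpha> :: real
  assumes "1 < \<alpha>" "0 < A" "0 \<le> x"
  shows "x powr (\<alpha> - 1) * (\<alpha> * A - x) \<le> (\<alpha> - 1) powr (\<alpha> - 1) * A powr \<alpha>"
proof (cases "x > 0 \<and> \<alpha> * A - x > 0")
  case True
  define y where "y = x / ((\<alpha> - 1) * A)"
  define z where "z = (\<alpha> * A - x) / A"
  have yz: "y > 0" "z > 0" using True assms by (auto simp: y_def z_def)
  have "(\<alpha> - 1) * y = x / A"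
    using assms by (simp add: y_def)
  then have zero: "(\<alpha> - 1) * (y - 1) + (z - 1) = 0"
    using assms by (simp add: z_def diff_divide_distrib right_diff_distrib)
  have "(\<alpha> - 1) * ln y + ln z \<le> (\<alpha> - 1) * (y - 1) + (z - 1)"
    using yz assms by (intro add_mono mult_left_mono ln_le_minus_one) auto
  then have "exp ((\<alpha> - 1) * ln y + ln z) \<le> 1"
    using zero by simp
  then have "y powr (\<alpha> - 1) * z \<le> 1"
    using yz by (simp add: powr_def exp_add)
  then have "y powr (\<alpha> - 1) * z * ((\<alpha> - 1) powr (\<alpha> - 1) * A powr \<alpha>)
       \<le> 1 * ((\<alpha> - 1) powr (\<alpha> - 1) * A powr \<alpha>)"
    by (intro mult_right_mono) auto
  moreover have "x powr (\<alpha> - 1) = y powr (\<alpha> - 1) * ((\<alpha> - 1) powr (\<alpha> - 1) * A powr (\<alpha> - 1))"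
    using assms yz(1) by (simp add: y_def powr_mult[symmetric])
  moreover have "\<alpha> * A - x = z * A"
    using assms by (simp add: z_def)
  moreover have "A powr \<alpha> = A powr (\<alpha> - 1) * A"
    using assms powr_add[of A "\<alpha> - 1" 1] by simp
  ultimately show ?thesis
    by (simp add: mult_ac)
next
  case False
  then have "x powr (\<alpha> - 1) * (\<alpha> * A - x) \<le> 0"
    using assms by (auto simp: mult_le_0_iff)
  also have "0 \<le> (\<alpha> - 1) powr (\<alpha> - 1) * A powr \<alpha>"
    by simp
  finally show ?thesis .
qed

lemma green_op_one_le:
  assumes "a < b" "1 < \<alpha>" "\<beta> \<le> \<alpha> - 1" and t: "t \<in> {a..b}"
  shows "green_op a b \<alpha> \<beta> (\<lambda>_. 1) t
     \<le> (\<alpha> - 1) powr (\<alpha> - 1) * ((b - a) / (\<alpha> - \<beta>)) powr \<alpha> / Gamma (\<alpha> + 1)"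
proof (cases "t = a")
  case True
  have "Gamma (\<alpha> + 1) > 0" using assms by (intro Gamma_real_pos) auto
  with True show ?thesis using assms by (simp add: green_op_def RL_integral_start)
next
  case False
  then have at: "a < t" "t \<le> b" using t by auto
  define A where "A = (b - a) / (\<alpha> - \<beta>)"
  have A: "A > 0" using assms by (simp add: A_def)
  have G: "Gamma (\<alpha> - \<beta>) > 0" "Gamma \<alpha> > 0" "Gamma (\<alpha> + 1) > 0"
    using assms by (auto intro!: Gamma_real_pos)
  have nn: "\<alpha> - \<beta> \<notin> \<int>\<^sub>\<le>\<^sub>0" "\<alpha> \<notin> \<int>\<^sub>\<le>\<^sub>0"
    using assms by auto
  have G1: "Gamma (\<alpha> - \<beta> + 1) = (\<alpha> - \<beta>) * Gamma (\<alpha> - \<beta>)" "Gamma (\<alpha> + 1) = \<alpha> * Gamma \<alpha>"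
    using Gamma_plus1[OF nn(1)] Gamma_plus1[OF nn(2)] by auto
  have "(b - a) powr (\<alpha> - \<beta>) = (b - a) powr (\<alpha> - \<beta> - 1) * (b - a)"
    using assms powr_add[of "b - a" "\<alpha> - \<beta> - 1" 1] by simp
  then have 1: "RL_integral a (\<alpha> - \<beta>) (\<lambda>_. 1) b / RL_integral a (\<alpha> - \<beta> - 1) (\<lambda>_. 1) b = A"
    using assms less_imp_neq[OF G(1)] by (simp add: RL_integral_const_one G1 A_def)
  have "(t - a) powr \<alpha> = (t - a) powr (\<alpha> - 1) * (t - a)"
    using at powr_add[of "t - a" "\<alpha> - 1" 1] by simp
  moreover have "RL_integral a (\<alpha> - 1) (\<lambda>_. 1) t = \<alpha> * (t - a) powr (\<alpha> - 1) / Gamma (\<alpha> + 1)"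
    using assms at by (simp add: RL_integral_const_one G1(2))
  ultimately have "green_op a b \<alpha> \<beta> (\<lambda>_. 1) t
      = (t - a) powr (\<alpha> - 1) * (\<alpha> * A - (t - a)) / Gamma (\<alpha> + 1)"
    unfolding green_op_def 1 using assms at
    by (simp add: RL_integral_const_one diff_divide_distrib left_diff_distrib right_diff_distrib mult_ac)
  also have "\<dots> \<le> (\<alpha> - 1) powr (\<alpha> - 1) * A powr \<alpha> / Gamma (\<alpha> + 1)"
    using assms A at G by (intro divide_right_mono powr_times_linear_le) auto
  finally show ?thesis by (simp add: A_def)
qed

section \<open>Existence and uniqueness\<close>

text \<open>
  Banach's theorem for functions that matter only on \<open>[a, b]\<close>. The complete space is that of
  bounded continuous functions on the line, into which \<open>C[a, b]\<close> embeds isometrically by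
  constant extension beyond the end points, that is, by composition with \<open>clamp a b\<close>.
\<close>

lemma contraction_unique_fixed_point_on_interval:
  fixes T :: "(real \<Rightarrow> real) \<Rightarrow> real \<Rightarrow> real"
  assumes "a \<le> b" "0 \<le> q" "q < 1"
    and cont: "\<And>u. continuous_on {a..b} u \<Longrightarrow> continuous_on {a..b} (T u)"
    and contr: "\<And>u v d t. continuous_on {a..b} u \<Longrightarrow> continuous_on {a..b} v \<Longrightarrow>
        (\<And>s. s \<in> {a..b} \<Longrightarrow> \<bar>u s - v s\<bar> \<le> d) \<Longrightarrow> t \<in> {a..b} \<Longrightarrow> \<bar>T u t - T v t\<bar> \<le> q * d"
  shows "\<exists>u. (continuous_on {a..b} u \<and> (\<forall>t\<in>{a..b}. u t = T u t)) \<and>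
       (\<forall>v. continuous_on {a..b} v \<and> (\<forall>t\<in>{a..b}. v t = T v t) \<longrightarrow> (\<forall>t\<in>{a..b}. v t = u t))"
proof -
  have clamp: "clamp a b x \<in> {a..b}" for x
    using clamp_in_interval[of a b x] assms(1) by simp
  have "\<exists>\<psi> :: real \<Rightarrow>\<^sub>C real. \<forall>x. \<psi> x = T \<phi> (clamp a b x)" for \<phi> :: "real \<Rightarrow>\<^sub>C real"
    by (rule continuous_on_cbox_bcontfunE[of a b "T \<phi>"]) (auto intro: cont)
  then have "\<exists>F :: (real \<Rightarrow>\<^sub>C real) \<Rightarrow> (real \<Rightarrow>\<^sub>C real).
      \<forall>\<phi> :: real \<Rightarrow>\<^sub>C real. \<forall>x. apply_bcontfun (F \<phi>) x = T (apply_bcontfun \<phi>) (clamp a b x)"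
    by (intro choice allI)
  then obtain F :: "(real \<Rightarrow>\<^sub>C real) \<Rightarrow> (real \<Rightarrow>\<^sub>C real)"
    where F: "\<And>\<phi> x. apply_bcontfun (F \<phi>) x = T (apply_bcontfun \<phi>) (clamp a b x)"
    by blast
  have "dist (F \<phi>) (F \<psi>) \<le> q * dist \<phi> \<psi>" for \<phi> \<psi>
  proof (rule dist_bound)
    fix x
    have "\<bar>T \<phi> (clamp a b x) - T \<psi> (clamp a b x)\<bar> \<le> q * dist \<phi> \<psi>"
      using dist_bounded[of \<phi> _ \<psi>] clamp by (intro contr) (auto simp: dist_real_def)
    then show "dist (F \<phi> x) (F \<psi> x) \<le> q * dist \<phi> \<psi>"
      by (simp add: F dist_real_def)
  qed
  then have "\<exists>!\<phi>. F \<phi> = \<phi>"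
    using assms by (intro banach_fix_type) auto
  then obtain \<phi> where F_fix: "F \<phi> = \<phi>" and uniq: "\<And>\<psi>. F \<psi> = \<psi> \<Longrightarrow> \<psi> = \<phi>"
    by blast
  have "\<phi> t = T \<phi> t" if "t \<in> {a..b}" for t
    using F[of \<phi> t] that by (simp add: F_fix)
  moreover have "v t = \<phi> t"
    if v: "continuous_on {a..b} v" "\<And>t. t \<in> {a..b} \<Longrightarrow> v t = T v t" and t: "t \<in> {a..b}" for v t
  proof -
    obtain \<psi> :: "real \<Rightarrow>\<^sub>C real" where
      \<psi>: "\<And>x. x \<in> {a..b} \<Longrightarrow> \<psi> x = v x" "\<And>x. \<psi> x = v (clamp a b x)"
      using continuous_on_cbox_bcontfunE[of a b v] v(1) by auto
    \<comment> \<open>The contraction bound with \<open>d = 0\<close>: \<open>T\<close> sees only the values on \<open>[a, b]\<close>.\<close>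
    have "T \<psi> s = T v s" if "s \<in> {a..b}" for s
      using contr[of \<psi> v 0 s] v(1) \<psi>(1) that by simp
    then have "F \<psi> = \<psi>"
      using clamp v(2) \<psi>(2) by (intro bcontfun_eqI) (metis F)
    then show ?thesis
      using uniq \<psi>(1) t by metis
  qed
  moreover have "continuous_on {a..b} \<phi>"
    by simp
  ultimately show ?thesis
    by blast
qed

theorem theorem4p2:
  fixes a b \<alpha> \<beta> K :: real and f :: "real \<Rightarrow> real \<Rightarrow> real"
  assumes "a < b"
    and "1 < \<alpha>" and "\<alpha> \<le> 2"
    and "0 \<le> \<beta>" and "\<beta> \<le> \<alpha> - 1"
    and "continuous_on ({a..b} \<times> UNIV) (\<lambda>(t, x). f t x)"
    and "K > 0"
    and "\<forall>t\<in>{a..b}. \<forall>u1 u2. \<bar>f t u1 - f t u2\<bar> \<le> K * \<bar>u1 - u2\<bar>"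
    and "b - a < (((\<alpha> - \<beta>) powr \<alpha> * Gamma (\<alpha> + 1)) /
                   (K * (\<alpha> - 1) powr (\<alpha> - 1))) powr (1 / \<alpha>)"
  shows "\<exists>u. is_BVP_solution a b \<alpha> \<beta> f u \<and>
             (\<forall>v. is_BVP_solution a b \<alpha> \<beta> f v \<longrightarrow> (\<forall>t\<in>{a..b}. v t = u t))"
proof -
  define B where "B = (\<alpha> - 1) powr (\<alpha> - 1) * ((b - a) / (\<alpha> - \<beta>)) powr \<alpha> / Gamma (\<alpha> + 1)"
  \<comment> \<open>\<open>B\<close> bounds \<open>G 1\<close>, so \<open>K B\<close> is a contraction constant; the hypothesis on \<open>b - a\<close> says \<open>(b - a)\<^sup>\<alpha> < X\<close>.\<close>
  define X where "X = ((\<alpha> - \<beta>) powr \<alpha> * Gamma (\<alpha> + 1)) / (K * (\<alpha> - 1) powr (\<alpha> - 1))"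
  have G: "Gamma (\<alpha> + 1) > 0"
    using assms by (intro Gamma_real_pos) auto
  have X: "X > 0"
    using assms G by (simp add: X_def)
  have q0: "0 \<le> K * B"
    using assms G by (simp add: B_def)
  have q1: "K * B < 1"
  proof -
    have "(b - a) powr \<alpha> < (X powr (1 / \<alpha>)) powr \<alpha>"
      using assms by (intro powr_less_mono2) (auto simp: X_def)
    also have "\<dots> = X"
      using X assms by (simp add: powr_powr)
    finally have "(b - a) powr \<alpha> < X" .
    moreover have "K * B = (b - a) powr \<alpha> / X"
      using assms by (simp add: B_def X_def powr_divide)
    ultimately show ?thesis
      using X by simp
  qed
  have f_cont: "continuous_on {a..b} (\<lambda>s. f s (u s))" if "continuous_on {a..b} u" for u
    using assms(6) that by (rule continuous_on_superposition)
  show ?thesis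
    unfolding is_BVP_solution_iff_green_op[OF assms(1-6)]
  proof (rule contraction_unique_fixed_point_on_interval[OF _ q0 q1])
    show "a \<le> b" using assms(1) by simp
  next
    fix u :: "real \<Rightarrow> real" assume "continuous_on {a..b} u"
    then show "continuous_on {a..b} (green_op a b \<alpha> \<beta> (\<lambda>s. f s (u s)))"
      using assms(2) f_cont by (intro continuous_on_green_op)
  next
    fix u v :: "real \<Rightarrow> real" and d t :: real
    assume uv: "continuous_on {a..b} u" "continuous_on {a..b} v"
      and d: "\<And>s. s \<in> {a..b} \<Longrightarrow> \<bar>u s - v s\<bar> \<le> d" and t: "t \<in> {a..b}"
    have "d \<ge> 0" using d[OF t] by linarith
    have lip: "\<bar>f s (u s) - f s (v s)\<bar> \<le> K * d" if "s \<in> {a..b}" for s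
    proof -
      have "\<bar>f s (u s) - f s (v s)\<bar> \<le> K * \<bar>u s - v s\<bar>"
        using assms(8) that by blast
      also have "\<dots> \<le> K * d"
        using d[OF that] assms(7) by simp
      finally show ?thesis .
    qed
    have "\<bar>green_op a b \<alpha> \<beta> (\<lambda>s. f s (u s)) t - green_op a b \<alpha> \<beta> (\<lambda>s. f s (v s)) t\<bar>
        = \<bar>green_op a b \<alpha> \<beta> (\<lambda>s. f s (u s) - f s (v s)) t\<bar>"
      using assms uv t f_cont by (simp add: green_op_diff)
    also have "\<dots> \<le> K * d * green_op a b \<alpha> \<beta> (\<lambda>_. 1) t"
      using assms(1,2,4,5) uv f_cont lip t by (intro abs_green_op_le continuous_on_diff) auto
    also have "\<dots> \<le> K * d * B"
      unfolding B_def using assms \<open>d \<ge> 0\<close> t by (intro mult_left_mono green_op_one_le) auto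
    finally show "\<bar>green_op a b \<alpha> \<beta> (\<lambda>s. f s (u s)) t - green_op a b \<alpha> \<beta> (\<lambda>s. f s (v s)) t\<bar>
        \<le> K * B * d"
      by (simp add: mult_ac)
  qed
qed

end
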